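(* Let $\ell\ge3$, let $\lambda$ be an $(\ell,0)$-JM partition and $0\le i<\ell$; put $\widehat\varphi=\widehat\varphi_i(\lambda)$ and $\widehat\varepsilon=\widehat\varepsilon_i(\lambda)$. Then (1) $\widehat f_i^{\widehat\varphi}\lambda$ is an $(\ell,0)$-JM partition; (2) $\widehat e_i^{\widehat\varepsilon}\lambda$ is an $(\ell,0)$-JM partition.
   Context: Young diagrams in English notation; $(a,b)$ is the box in row $a$, column $b$, residue $b-a\bmod\ell$. Hook length $h^\lambda_{(a,b)}$: number of boxes of $\lambda$ in row $a$ weakly right of $(a,b)$ plus those in column $b$ strictly below. $\lambda$ is an $(\ell,0)$-JM partition if there are no boxes $(a,b),(a,y),(x,b)$ of $\lambda$ with $\ell\mid h^\lambda_{(a,b)}$, $\ell\nmid h^\lambda_{(a,y)}$, $\ell\nmid h^\lambda_{(x,b)}$. Removable (resp. addable) $i$-box: a box in $\lambda$ (resp. position not in $\lambda$) of residue $i$ whose removal (resp. addition) yields a partition. The ladder of $(a,b)$ is the set of positions $(c,d)$, $c,d\ge1$, with $c+(\ell-1)d=a+(\ell-1)b$; ladders are ordered left to right by increasing $c+(\ell-1)d$, within a ladder top to bottom by increasing row index. Ladder crystal: the ladder $i$-signature of $\lambda$ writes $+$ for each addable $i$-box and $-$ for each removable $i$-box, reading ladders left to right and each ladder top to bottom; repeatedly deleting adjacent "$-+$" gives $+\cdots+-\cdots-$. Remaining $-$'s are ladder normal $i$-boxes (leftmost: ladder good), remaining $+$'s ladder conormal (rightmost: ladder cogood). $\widehat f_i\lambda$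 adds the ladder cogood $i$-box, $\widehat e_i\lambda$ removes the ladder good $i$-box ($0$ if none); $\widehat\varphi_i(\lambda)$, $\widehat\varepsilon_i(\lambda)$ are the numbers of ladder conormal, ladder normal $i$-boxes. *)

theory Defs
  imports Main
begin

text \<open>Partitions are identified with their Young diagrams in English notation: a box is a pair
  (row, column) of positive integers.\<close>

type_synonym box = "nat \<times> nat"

definition young_diagram :: "box set \<Rightarrow> bool" where
  "young_diagram D \<longleftrightarrow> finite D \<and> (\<forall>(a, b)\<in>D. 1 \<le> a \<and> 1 \<le> b) \<and>
     (\<forall>a b c d. (a, b) \<in> D \<longrightarrow> 1 \<le> c \<longrightarrow> c \<le> a \<longrightarrow> 1 \<le> d \<longrightarrow> d \<le> b \<longrightarrow> (c, d) \<in> D)"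

definition residue :: "nat \<Rightarrow> box \<Rightarrow> int" where
  "residue l p = (int (snd p) - int (fst p)) mod int l"

definition hook_length :: "box set \<Rightarrow> box \<Rightarrow> nat" where
  "hook_length D p = card {y. snd p \<le> y \<and> (fst p, y) \<in> D} + card {x. fst p < x \<and> (x, snd p) \<in> D}"

definition JM_partition :: "nat \<Rightarrow> box set \<Rightarrow> bool" where
  "JM_partition l D \<longleftrightarrow> young_diagram D \<and>
     \<not> (\<exists>a b x y. (a, b) \<in> D \<and> (a, y) \<in> D \<and> (x, b) \<in> D \<and>
          l dvd hook_length D (a, b) \<and> \<not> l dvd hook_length D (a, y) \<and> \<not> l dvd hook_length D (x, b))"

definition removable_boxes :: "nat \<Rightarrow> int \<Rightarrow> box set \<Rightarrow> box set" where
  "removable_boxes l i D = {p. p \<in> D \<and> residue l p = i \<and> young_diagram (D - {p})}"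

definition addable_boxes :: "nat \<Rightarrow> int \<Rightarrow> box set \<Rightarrow> box set" where
  "addable_boxes l i D = {p. p \<notin> D \<and> residue l p = i \<and> young_diagram (insert p D)}"

text \<open>Two positions lie on the same ladder iff they have the same ladder number.\<close>

definition ladder_number :: "nat \<Rightarrow> box \<Rightarrow> nat" where
  "ladder_number l p = fst p + (l - 1) * snd p"

text \<open>The elements of a finite set of positions, ladder by ladder in increasing order of ladder
  number, and by increasing row within a ladder. For \<open>2 \<le> l\<close> the row determines the position
  within its ladder, so every element is listed exactly once.\<close>

definition ladder_reading :: "nat \<Rightarrow> box set \<Rightarrow> box list" where
  "ladder_reading l A =
     concat (map (\<lambda>k. sorted_key_list_of_set fst {p \<in> A. ladder_number l p = k})
                 (sorted_list_of_set (ladder_number l ` A)))"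

datatype sign = Plus | Minus

text \<open>Every sign of a signature is recorded together with the box it comes from.\<close>

definition ladder_signature :: "nat \<Rightarrow> int \<Rightarrow> box set \<Rightarrow> (sign \<times> box) list" where
  "ladder_signature l i D =
     map (\<lambda>p. (if p \<in> addable_boxes l i D then Plus else Minus, p))
         (ladder_reading l (addable_boxes l i D \<union> removable_boxes l i D))"

inductive delete_step :: "(sign \<times> 'b) list \<Rightarrow> (sign \<times> 'b) list \<Rightarrow> bool" where
  "delete_step (us @ (Minus, p) # (Plus, q) # vs) (us @ vs)"

text \<open>The result of deleting adjacent minus-plus pairs until none is left; it exists and is unique
  by \<open>reduced_exists_unique\<close> below.\<close>

definition reduced :: "(sign \<times> 'b) list \<Rightarrow> (sign \<times> 'b) list" where
  "reduced xs = (THE ys. delete_step\<^sup>*\<^sup>* xs ys \<and> \<not> (\<exists>zs. delete_step ys zs))"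

definition conormal_boxes :: "nat \<Rightarrow> int \<Rightarrow> box set \<Rightarrow> box list" where
  "conormal_boxes l i D = map snd (filter (\<lambda>s. fst s = Plus) (reduced (ladder_signature l i D)))"

definition normal_boxes :: "nat \<Rightarrow> int \<Rightarrow> box set \<Rightarrow> box list" where
  "normal_boxes l i D = map snd (filter (\<lambda>s. fst s = Minus) (reduced (ladder_signature l i D)))"

definition phi_hat :: "nat \<Rightarrow> int \<Rightarrow> box set \<Rightarrow> nat" where
  "phi_hat l i D = length (conormal_boxes l i D)"

definition epsilon_hat :: "nat \<Rightarrow> int \<Rightarrow> box set \<Rightarrow> nat" where
  "epsilon_hat l i D = length (normal_boxes l i D)"

text \<open>The value 0 of a crystal operator is \<open>None\<close>, as opposed to the empty partition
  \<open>Some {}\<close>. The cogood box is the last conormal box, the good box the first normal box.\<close>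

definition f_hat :: "nat \<Rightarrow> int \<Rightarrow> box set \<Rightarrow> box set option" where
  "f_hat l i D = (if conormal_boxes l i D = [] then None
                  else Some (insert (last (conormal_boxes l i D)) D))"

definition e_hat :: "nat \<Rightarrow> int \<Rightarrow> box set \<Rightarrow> box set option" where
  "e_hat l i D = (if normal_boxes l i D = [] then None
                  else Some (D - {hd (normal_boxes l i D)}))"

fun iterate_partial :: "('a \<Rightarrow> 'a option) \<Rightarrow> nat \<Rightarrow> 'a \<Rightarrow> 'a option" where
  "iterate_partial g 0 x = Some x"
| "iterate_partial g (Suc n) x = Option.bind (iterate_partial g n x) g"

fun cancel :: "(sign \<times> 'b) list \<Rightarrow> (sign \<times> 'b) list" where
  "cancel [] = []"
| "cancel (x # xs) =
     (case cancel xs of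
        [] \<Rightarrow> [x]
      | y # ys \<Rightarrow> if fst x = Minus \<and> fst y = Plus then ys else x # y # ys)"

lemma delete_step_Cons: "delete_step xs ys \<Longrightarrow> delete_step (x # xs) (x # ys)"
  by (metis append_Cons delete_step.cases delete_step.intros)

lemma delete_steps_Cons: "delete_step\<^sup>*\<^sup>* xs ys \<Longrightarrow> delete_step\<^sup>*\<^sup>* (x # xs) (x # ys)"
  by (induction rule: rtranclp_induct)
     (auto intro: delete_step_Cons rtranclp.rtrancl_into_rtrancl)

lemma delete_step_cancel: "delete_step xs ys \<Longrightarrow> cancel xs = cancel ys"
proof (induction rule: delete_step.induct)
  case (1 us p q vs)
  show ?case by (induction us) (auto split: list.splits)
qed

lemma delete_steps_cancel: "delete_step\<^sup>*\<^sup>* xs ys \<Longrightarrow> cancel xs = cancel ys"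
  by (induction rule: rtranclp_induct) (auto dest: delete_step_cancel)

lemma delete_steps_to_cancel: "delete_step\<^sup>*\<^sup>* xs (cancel xs)"
proof (induction xs)
  case Nil
  show ?case by simp
next
  case (Cons x xs)
  have 1: "delete_step\<^sup>*\<^sup>* (x # xs) (x # cancel xs)"
    using Cons by (rule delete_steps_Cons)
  show ?case
  proof (cases "\<exists>y ys. cancel xs = y # ys \<and> fst x = Minus \<and> fst y = Plus")
    case True
    then obtain y ys where y: "cancel xs = y # ys" "fst x = Minus" "fst y = Plus" by blast
    then have "delete_step (x # cancel xs) ys"
      using delete_step.intros[of "[]" "snd x" "snd y" ys] by (cases x; cases y) auto
    with 1 y show ?thesis by auto
  next
    case False
    then have "cancel (x # xs) = x # cancel xs" by (auto split: list.splits)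
    with 1 show ?thesis by simp
  qed
qed

lemma irreducible_cancel: "\<not> (\<exists>zs. delete_step xs zs) \<Longrightarrow> cancel xs = xs"
proof (induction xs)
  case (Cons x xs)
  then have "cancel xs = xs" using delete_step_Cons by blast
  moreover have "\<not> (fst x = Minus \<and> fst y = Plus)" if "xs = y # ys" for y ys
    using Cons.prems that delete_step.intros[of "[]" "snd x" "snd y" ys]
    by (cases x; cases y) auto
  ultimately show ?case by (auto split: list.splits)
qed simp

lemma cancel_irreducible: "\<not> delete_step (cancel xs) zs"
proof -
  have len: "length (cancel ys) \<le> length ys" for ys :: "(sign \<times> 'b) list"
  proof (induction ys)
    case (Cons a ys)
    then show ?case by (auto split: list.splits)
  qed simp
  have idem: "cancel (cancel xs) = cancel xs"
    using delete_steps_cancel[OF delete_steps_to_cancel, of xs] by simp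
  show ?thesis
  proof
    assume st: "delete_step (cancel xs) zs"
    then have "length zs < length (cancel xs)" by (cases rule: delete_step.cases) auto
    moreover have "cancel zs = cancel xs" using delete_step_cancel[OF st] idem by simp
    ultimately show False using len[of zs] by simp
  qed
qed

lemma reduced_exists_unique:
  "\<exists>!ys. delete_step\<^sup>*\<^sup>* xs ys \<and> \<not> (\<exists>zs. delete_step ys zs)"
proof (rule ex1I[of _ "cancel xs"])
  show "delete_step\<^sup>*\<^sup>* xs (cancel xs) \<and> \<not> (\<exists>zs. delete_step (cancel xs) zs)"
    by (simp add: delete_steps_to_cancel cancel_irreducible)
next
  fix ys
  assume "delete_step\<^sup>*\<^sup>* xs ys \<and> \<not> (\<exists>zs. delete_step ys zs)"
  then show "ys = cancel xs"
    using delete_steps_cancel irreducible_cancel by metis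
qed

lemma reduced_eq_cancel: "reduced xs = cancel xs"
  unfolding reduced_def
  by (rule the1_equality[OF reduced_exists_unique])
     (simp add: delete_steps_to_cancel cancel_irreducible)

end

theory Submission
  imports Defs
begin

text \<open>Encode a partition by the beads \<open>\<lambda>\<^sub>a - a\<close>; the remaining integers are the gaps
  \<open>b - 1 - \<lambda>'\<^sub>b\<close>, boxes are pairs bead > gap, and the hook length is bead minus gap. The partition is JM
  iff no bead \<open>x\<close> exceeds a gap \<open>y\<close> on its runner while \<open>x\<close> exceeds a gap and \<open>y\<close> is exceeded by a bead on
  other runners. For a JM partition every addable \<open>i\<close>-box precedes every removable \<open>i\<close>-box in the ladder
  order, so nothing cancels and the two iterated operators add all addable, respectively remove all
  removable, \<open>i\<close>-boxes. On the abacus this replaces the runners \<open>i - 1\<close> and \<open>i\<close> by their intersection and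
  union (in one order or the other), and a violation of the JM condition in the result can be shifted by
  at most one position to a violation in the original.\<close>

section \<open>Signatures without cancellation\<close>

text \<open>No \<open>Minus\<close> stands directly before a \<open>Plus\<close>, so there is
  nothing to delete.\<close>

lemma cancel_Plus_Minus:
  "cancel (map (Pair Plus) ps @ map (Pair Minus) ms) = map (Pair Plus) ps @ map (Pair Minus) ms"
proof (induction ps)
  case Nil
  show ?case by (induction ms) (auto split: list.splits)
next
  case (Cons p ps)
  then show ?case by (auto split: list.splits)
qed

lemma sorted_wrt_concat:
  assumes "sorted_wrt (\<lambda>xs ys. \<forall>x\<in>set xs. \<forall>y\<in>set ys. R x y) xss"
    and "\<forall>xs\<in>set xss. sorted_wrt R xs"
  shows "sorted_wrt R (concat xss)"
  using assms by (induction xss) (auto simp: sorted_wrt_append)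

text \<open>Once an entry outside \<open>P\<close> has occurred, no later entry can satisfy
  \<open>P\<close>. This will split the ladder reading into addable boxes followed by removable
  ones.\<close>

lemma sorted_wrt_partition:
  assumes "sorted_wrt R xs"
    and "\<And>x y. x \<in> set xs \<Longrightarrow> y \<in> set xs \<Longrightarrow> \<not> P x \<Longrightarrow> P y \<Longrightarrow> \<not> R x y"
  shows "xs = filter P xs @ filter (\<lambda>x. \<not> P x) xs"
  using assms
proof (induction xs)
  case (Cons x xs)
  have IH: "xs = filter P xs @ filter (\<lambda>x. \<not> P x) xs"
    using Cons by auto
  show ?case
  proof (cases "P x")
    case True
    then show ?thesis using IH by simp
  next
    case False
    then have "\<forall>y\<in>set xs. \<not> P y" using Cons.prems by auto
    then show ?thesis using False by simp
  qed
qed simp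

section \<open>The ladder reading as a sorted list\<close>

context linorder
begin

text \<open>The locale \<open>folding_insort_key\<close> asks for a key that is injective on an
  ambient set; the set \<open>A\<close> to be sorted serves as that set.\<close>

lemma
  assumes "inj_on f A"
  shows set_sorted_key_list_of_set_inj: "finite A \<Longrightarrow> set (sorted_key_list_of_set f A) = A"
    and sorted_wrt_sorted_key_list_of_set_inj:
      "sorted_wrt (\<lambda>x y. f x < f y) (sorted_key_list_of_set f A)"
proof -
  interpret folding_insort_key "(\<le>)" "(<)" A f
    by standard (rule assms)
  show "finite A \<Longrightarrow> set (sorted_key_list_of_set f A) = A" by simp
  show "sorted_wrt (\<lambda>x y. f x < f y) (sorted_key_list_of_set f A)"
    using strict_sorted_key_list_of_set[of A] by (simp add: sorted_wrt_map)
qed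

end

text \<open>Irreflexivity of this order makes the reading distinct; its asymmetry lets it separate
  addable from removable boxes.\<close>

definition ladder_less :: "nat \<Rightarrow> box \<Rightarrow> box \<Rightarrow> bool" where
  "ladder_less l p q \<longleftrightarrow> ladder_number l p < ladder_number l q \<or>
     ladder_number l p = ladder_number l q \<and> fst p < fst q"

lemma ladder_reading:
  assumes "2 \<le> l" and "finite A"
  shows "set (ladder_reading l A) = A" and "sorted_wrt (ladder_less l) (ladder_reading l A)"
proof -
  let ?L = "\<lambda>k. {p \<in> A. ladder_number l p = k}"
  let ?s = "\<lambda>k. sorted_key_list_of_set fst (?L k)"
  \<comment> \<open>On one ladder the row fixes the column because \<open>l - 1\<close> is
    positive.\<close>
  have inj: "inj_on fst (?L k)" for k
    using assms(1) by (auto simp: inj_on_def ladder_number_def)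
  have set_s: "set (?s k) = ?L k" and sorted_s: "sorted_wrt (ladder_less l) (?s k)" for k
  proof -
    show set_s: "set (?s k) = ?L k"
      using assms(2) by (intro set_sorted_key_list_of_set_inj inj) simp
    have "sorted_wrt (\<lambda>p q. fst p < fst q) (?s k)"
      by (rule sorted_wrt_sorted_key_list_of_set_inj[OF inj])
    then show "sorted_wrt (ladder_less l) (?s k)"
      by (rule sorted_wrt_mono_rel[rotated]) (auto simp: set_s ladder_less_def)
  qed
  show "set (ladder_reading l A) = A"
    using assms(2) by (auto simp: ladder_reading_def set_s)
  have "sorted_wrt (\<lambda>xs ys. \<forall>x\<in>set xs. \<forall>y\<in>set ys. ladder_less l x y)
          (map ?s (sorted_list_of_set (ladder_number l ` A)))"
    unfolding sorted_wrt_map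
    by (rule sorted_wrt_mono_rel[OF _ strict_sorted_list_of_set]) (auto simp: set_s ladder_less_def)
  then show "sorted_wrt (ladder_less l) (ladder_reading l A)"
    unfolding ladder_reading_def by (rule sorted_wrt_concat) (auto simp: sorted_s)
qed

lemma distinct_ladder_reading:
  assumes "2 \<le> l" and "finite A"
  shows "distinct (ladder_reading l A)"
proof -
  have "distinct xs" if "sorted_wrt (ladder_less l) xs" for xs
    using that by (induction xs) (auto simp: ladder_less_def)
  then show ?thesis using ladder_reading(2)[OF assms] by blast
qed

section \<open>Addable and removable boxes\<close>

lemma young_diagramD:
  assumes "young_diagram D"
  shows "finite D" and "(a, b) \<in> D \<Longrightarrow> 1 \<le> a" and "(a, b) \<in> D \<Longrightarrow> 1 \<le> b"
    and "(a, b) \<in> D \<Longrightarrow> 1 \<le> c \<Longrightarrow> c \<le> a \<Longrightarrow> 1 \<le> d \<Longrightarrow> d \<le> b \<Longrightarrow> (c, d) \<in> D"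
  using assms unfolding young_diagram_def by blast+

text \<open>A position weakly north-west of \<open>(a, b)\<close> and different from it is weakly
  north-west of the upper or of the left neighbour, so only these two have to be checked.\<close>

lemma young_diagram_insert_iff:
  assumes "young_diagram D"
  shows "young_diagram (insert (a, b) D) \<longleftrightarrow> (a, b) \<in> D \<or>
    1 \<le> a \<and> 1 \<le> b \<and> (a = 1 \<or> (a - 1, b) \<in> D) \<and> (b = 1 \<or> (a, b - 1) \<in> D)"
    (is "?Y \<longleftrightarrow> _ \<or> ?R")
proof (cases "(a, b) \<in> D")
  case True
  then show ?thesis using assms by (simp add: insert_absorb)
next
  case False
  note D = young_diagramD[OF assms]
  have "?R" if Y: "?Y"
  proof -
    note Y = young_diagramD[OF Y]
    have ab: "1 \<le> a" "1 \<le> b" using Y(2,3) by auto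
    have "(a - 1, b) \<in> D" if "a \<noteq> 1"
    proof -
      have "1 \<le> a - 1" using ab that by linarith
      then show ?thesis using Y(4)[of a b "a - 1" b] ab by auto
    qed
    moreover have "(a, b - 1) \<in> D" if "b \<noteq> 1"
    proof -
      have "1 \<le> b - 1" using ab that by linarith
      then show ?thesis using Y(4)[of a b a "b - 1"] ab by auto
    qed
    ultimately show ?thesis using ab by blast
  qed
  moreover have "?Y" if R: "?R"
    unfolding young_diagram_def
  proof (intro conjI allI impI)
    fix x y c d
    assume *: "(x, y) \<in> insert (a, b) D" "1 \<le> c" "c \<le> x" "1 \<le> d" "d \<le> y"
    show "(c, d) \<in> insert (a, b) D"
    proof (cases "(x, y) \<in> D")
      case True
      then show ?thesis using D(4) * by blast
    next
      case False
      then have xy: "x = a" "y = b" using *(1) by auto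
      consider "c = a" "d = b" | "c < a" | "d < b" using * xy by linarith
      then show ?thesis
      proof cases
        case 2
        then have "(a - 1, b) \<in> D" using R * by auto
        from D(4)[OF this, of c d] 2 * xy show ?thesis by auto
      next
        case 3
        then have "(a, b - 1) \<in> D" using R * by auto
        from D(4)[OF this, of c d] 3 * xy show ?thesis by auto
      qed simp
    qed
  qed (use D(1-3) R in auto)
  ultimately show ?thesis using False by blast
qed

text \<open>Removal fails only if another box of \<open>D\<close> is weakly south-east of
  \<open>(a, b)\<close>, and then the lower or the right neighbour of \<open>(a, b)\<close> lies in
  \<open>D\<close> as well.\<close>

lemma young_diagram_remove_iff:
  assumes "young_diagram D" and "(a, b) \<in> D"
  shows "young_diagram (D - {(a, b)}) \<longleftrightarrow> (Suc a, b) \<notin> D \<and> (a, Suc b) \<notin> D" (is "?Y \<longleftrightarrow> ?R")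
proof
  note D = young_diagramD[OF assms(1)]
  have ab: "1 \<le> a" "1 \<le> b" using D(2,3) assms(2) by auto
  {
    assume ?Y
    note Y = young_diagramD(4)[OF this]
    show ?R using Y[of "Suc a" b a b] Y[of a "Suc b" a b] ab by auto
  next
    assume R: ?R
    show ?Y
      unfolding young_diagram_def
    proof (intro conjI allI impI)
      fix x y c d
      assume *: "(x, y) \<in> D - {(a, b)}" "1 \<le> c" "c \<le> x" "1 \<le> d" "d \<le> y"
      have "(c, d) \<in> D" using D(4)[of x y c d] * by auto
      moreover have False if "c = a" "d = b"
      proof -
        have "Suc a \<le> x \<or> Suc b \<le> y" using * that by auto
        then show False using D(4)[of x y "Suc a" b] D(4)[of x y a "Suc b"] R * ab that by auto
      qed
      ultimately show "(c, d) \<in> D - {(a, b)}" by auto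
    qed (use D(1-3) in auto)
  }
qed

lemma mem_addable_iff:
  assumes "young_diagram D"
  shows "(a, b) \<in> addable_boxes l i D \<longleftrightarrow> (a, b) \<notin> D \<and> residue l (a, b) = i \<and>
    1 \<le> a \<and> 1 \<le> b \<and> (a = 1 \<or> (a - 1, b) \<in> D) \<and> (b = 1 \<or> (a, b - 1) \<in> D)"
  using young_diagram_insert_iff[OF assms] by (auto simp: addable_boxes_def)

lemma mem_removable_iff:
  assumes "young_diagram D"
  shows "(a, b) \<in> removable_boxes l i D \<longleftrightarrow> (a, b) \<in> D \<and> residue l (a, b) = i \<and>
    (Suc a, b) \<notin> D \<and> (a, Suc b) \<notin> D"
  using young_diagram_remove_iff[OF assms] by (auto simp: removable_boxes_def)

section \<open>Effect of adding or removing one \<open>i\<close>-box on the others\<close>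

lemma residue_eq_iff: "residue l p = residue l q \<longleftrightarrow>
    int l dvd (int (snd p) - int (fst p)) - (int (snd q) - int (fst q))"
  by (simp add: residue_def mod_eq_dvd_iff)

lemma residue_neighbours:
  assumes "2 \<le> l"
  shows "residue l (Suc a, b) \<noteq> residue l (a, b)" and "residue l (a, Suc b) \<noteq> residue l (a, b)"
  using assms by (auto simp: residue_eq_iff zdvd1_eq)

text \<open>Being addable or removable depends only on a position and its neighbours, and the
  neighbours of an \<open>i\<close>-box have other residues. So only the status of \<open>p\<close>
  itself changes.\<close>

lemma
  assumes "2 \<le> l" and "young_diagram D" and "p \<in> addable_boxes l i D"
  shows addable_insert: "addable_boxes l i (insert p D) = addable_boxes l i D - {p}"
    and removable_insert: "removable_boxes l i (insert p D) = insert p (removable_boxes l i D)"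
proof -
  obtain a b where p: "p = (a, b)" by (cases p)
  have Y: "young_diagram (insert p D)" using assms(3) by (simp add: addable_boxes_def)
  have res: "residue l (a, b) = i" using assms(3) p by (simp add: addable_boxes_def)
  note p_add = assms(3)[unfolded p mem_addable_iff[OF assms(2)]]
  note nb = residue_neighbours[OF assms(1)]
  have nbr: "(c - 1, d) \<noteq> p" "(c, d - 1) \<noteq> p" if "residue l (c, d) = i" "1 \<le> c" "1 \<le> d" for c d
    using that nb(1)[of "c - 1" d] nb(2)[of c "d - 1"] p res by auto
  have "(c, d) \<in> addable_boxes l i (insert p D) \<longleftrightarrow> (c, d) \<in> addable_boxes l i D - {p}" for c d
    using nbr[of c d] by (auto simp: mem_addable_iff[OF Y] mem_addable_iff[OF assms(2)])
  then show "addable_boxes l i (insert p D) = addable_boxes l i D - {p}" by auto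
  have p_rem: "(a, b) \<in> removable_boxes l i (insert p D)"
  proof -
    have "(Suc a, b) \<notin> D" "(a, Suc b) \<notin> D"
      using p_add young_diagramD(4)[OF assms(2), of _ _ a b] by (meson le_SucI order_refl)+
    then show ?thesis using p_add unfolding p by (simp add: mem_removable_iff[OF Y[unfolded p]])
  qed
  have "(c, d) \<in> removable_boxes l i (insert p D) \<longleftrightarrow> (c, d) \<in> removable_boxes l i D"
    if "(c, d) \<noteq> p" for c d
    using that nb[of c d] res unfolding p
    by (auto simp: mem_removable_iff[OF Y[unfolded p]] mem_removable_iff[OF assms(2)])
  then have "q \<in> removable_boxes l i (insert p D) \<longleftrightarrow> q \<in> insert p (removable_boxes l i D)" for q
    using p_rem p by (cases q; cases "q = p") auto
  then show "removable_boxes l i (insert p D) = insert p (removable_boxes l i D)" by blast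
qed

text \<open>Removing \<open>p\<close> undoes its addition to \<open>D - {p}\<close>, so the
  preceding facts apply with \<open>D - {p}\<close> as the starting diagram.\<close>

lemma
  assumes "2 \<le> l" and "young_diagram D" and "p \<in> removable_boxes l i D"
  shows addable_remove: "addable_boxes l i (D - {p}) = insert p (addable_boxes l i D)"
    and removable_remove: "removable_boxes l i (D - {p}) = removable_boxes l i D - {p}"
    and mem_addable_remove: "p \<in> addable_boxes l i (D - {p})"
proof -
  have p: "p \<in> D" "insert p (D - {p}) = D" "young_diagram (D - {p})"
    using assms(3) by (auto simp: removable_boxes_def)
  show add: "p \<in> addable_boxes l i (D - {p})"
    using assms(2,3) p by (simp add: addable_boxes_def removable_boxes_def)
  have "p \<notin> removable_boxes l i (D - {p})" by (simp add: removable_boxes_def)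
  then show "addable_boxes l i (D - {p}) = insert p (addable_boxes l i D)"
    and "removable_boxes l i (D - {p}) = removable_boxes l i D - {p}"
    using addable_insert[OF assms(1) p(3) add] removable_insert[OF assms(1) p(3) add] p(2) add
    by auto
qed

lemma finite_addable:
  assumes "young_diagram D"
  shows "finite (addable_boxes l i D)"
proof (rule finite_subset)
  \<comment> \<open>The upper and left neighbours of an addable box, where they exist as positions,
    are boxes of \<open>D\<close>, which bounds both coordinates.\<close>
  show "addable_boxes l i D \<subseteq> insert 1 (Suc ` fst ` D) \<times> insert 1 (Suc ` snd ` D)"
    by (force simp: mem_addable_iff[OF assms] image_iff)
  show "finite (insert 1 (Suc ` fst ` D) \<times> insert 1 (Suc ` snd ` D))"
    using young_diagramD(1)[OF assms] by simp
qed

lemma finite_removable: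
  assumes "young_diagram D"
  shows "finite (removable_boxes l i D)"
  using young_diagramD(1)[OF assms] by (auto simp: removable_boxes_def intro: finite_subset)

section \<open>Beads and gaps\<close>

definition row_length :: "box set \<Rightarrow> nat \<Rightarrow> nat" where
  "row_length D a = card {y. (a, y) \<in> D}"

definition column_length :: "box set \<Rightarrow> nat \<Rightarrow> nat" where
  "column_length D b = card {x. (x, b) \<in> D}"

definition bead :: "box set \<Rightarrow> nat \<Rightarrow> int" where
  "bead D a = int (row_length D a) - int a"

text \<open>The shift by one makes the gaps complementary to the beads: for the empty diagram the
  beads are the negative integers and the gaps all others.\<close>

definition gap :: "box set \<Rightarrow> nat \<Rightarrow> int" where
  "gap D b = int b - 1 - int (column_length D b)"

text \<open>Empty rows count too, with bead \<open>- a\<close>, so this is the Maya diagram of the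
  partition, containing all sufficiently negative integers.\<close>

definition beads :: "box set \<Rightarrow> int set" where
  "beads D = bead D ` {1..}"

definition content :: "box \<Rightarrow> int" where
  "content p = int (snd p) - int (fst p)"

section \<open>Boxes and hook lengths in terms of beads and gaps\<close>

lemma initial_segment_card:
  fixes S :: "nat set"
  assumes "finite S" and "\<And>x. x \<in> S \<Longrightarrow> 1 \<le> x"
    and "\<And>x y. x \<in> S \<Longrightarrow> 1 \<le> y \<Longrightarrow> y \<le> x \<Longrightarrow> y \<in> S"
  shows "S = {1..card S}"
proof (cases "S = {}")
  case False
  then have "Max S \<in> S" using assms(1) by simp
  then have "x \<in> S \<longleftrightarrow> 1 \<le> x \<and> x \<le> Max S" for x
    using assms(2) assms(3)[of "Max S" x] Max_ge[OF assms(1), of x] by blast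
  then obtain m where "S = {1..m}" by (metis atLeastAtMost_iff subsetI subset_antisym)
  then show ?thesis by simp
qed simp

lemma row_eq:
  assumes "young_diagram D"
  shows "{y. (a, y) \<in> D} = {1..row_length D a}"
  unfolding row_length_def
proof (rule initial_segment_card)
  have "{y. (a, y) \<in> D} \<subseteq> snd ` D" by force
  then show "finite {y. (a, y) \<in> D}"
    using young_diagramD(1)[OF assms] by (auto intro: finite_subset)
qed (use young_diagramD[OF assms] in blast)+

lemma column_eq:
  assumes "young_diagram D"
  shows "{x. (x, b) \<in> D} = {1..column_length D b}"
  unfolding column_length_def
proof (rule initial_segment_card)
  have "{x. (x, b) \<in> D} \<subseteq> fst ` D" by force
  then show "finite {x. (x, b) \<in> D}"
    using young_diagramD(1)[OF assms] by (auto intro: finite_subset)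
qed (use young_diagramD[OF assms] in blast)+

lemma mem_iff_row: "young_diagram D \<Longrightarrow> (a, b) \<in> D \<longleftrightarrow> 1 \<le> b \<and> b \<le> row_length D a"
  using row_eq[of D a] by auto

lemma mem_iff_column: "young_diagram D \<Longrightarrow> (a, b) \<in> D \<longleftrightarrow> 1 \<le> a \<and> a \<le> column_length D b"
  using column_eq[of D b] by auto

text \<open>Bead minus gap is \<open>(row_length D a - b) + (column_length D b - a) + 1\<close>.
  Both brackets are nonnegative for a box and both are at most -1 otherwise, so the value is at
  least 1 or at most -1. It is never 0, whence \<open>gap_neq_bead\<close>.\<close>

lemma mem_iff_gap_less_bead:
  assumes "young_diagram D" and "1 \<le> a" and "1 \<le> b"
  shows "(a, b) \<in> D \<longleftrightarrow> gap D b < bead D a"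
  using mem_iff_row[OF assms(1), of a b] mem_iff_column[OF assms(1), of a b] assms(2,3)
  unfolding bead_def gap_def by (cases "(a, b) \<in> D") linarith+

lemma gap_neq_bead:
  assumes "young_diagram D" and "1 \<le> a" and "1 \<le> b"
  shows "gap D b \<noteq> bead D a"
  using mem_iff_row[OF assms(1), of a b] mem_iff_column[OF assms(1), of a b] assms(2,3)
  unfolding bead_def gap_def by (cases "(a, b) \<in> D") linarith+

text \<open>The row part of the hook counts \<open>row_length D a - b + 1\<close> boxes, the column
  part \<open>column_length D b - a\<close>.\<close>

lemma hook_length_eq:
  assumes "young_diagram D" and "(a, b) \<in> D"
  shows "int (hook_length D (a, b)) = bead D a - gap D b"
proof -
  have "{y. b \<le> y \<and> (a, y) \<in> D} = {b..row_length D a}"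
    using mem_iff_row[OF assms(1)] assms(2) by auto
  moreover have "{x. a < x \<and> (x, b) \<in> D} = {a<..column_length D b}"
    using mem_iff_column[OF assms(1)] assms(2) by auto
  moreover have "b \<le> row_length D a" "a \<le> column_length D b"
    using mem_iff_row[OF assms(1)] mem_iff_column[OF assms(1)] assms(2) by auto
  ultimately show ?thesis by (simp add: hook_length_def bead_def gap_def)
qed

lemma bead_strict_decreasing:
  assumes "young_diagram D" and "1 \<le> a" and "a < a'"
  shows "bead D a' < bead D a"
proof -
  have "row_length D a' \<le> row_length D a"
  proof (cases "row_length D a' = 0")
    case False
    then have "(a', row_length D a') \<in> D" by (simp add: mem_iff_row[OF assms(1)])
    then have "(a, row_length D a') \<in> D"
      using young_diagramD(4)[OF assms(1)] assms(2,3) False by simp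
    then show ?thesis by (simp add: mem_iff_row[OF assms(1)])
  qed simp
  then show ?thesis using assms(3) by (simp add: bead_def)
qed

lemma gap_strict_increasing:
  assumes "young_diagram D" and "1 \<le> b" and "b < b'"
  shows "gap D b < gap D b'"
proof -
  have "column_length D b' \<le> column_length D b"
  proof (cases "column_length D b' = 0")
    case False
    then have "(column_length D b', b') \<in> D" by (simp add: mem_iff_column[OF assms(1)])
    then have "(column_length D b', b) \<in> D"
      using young_diagramD(4)[OF assms(1)] assms(2,3) False by simp
    then show ?thesis by (simp add: mem_iff_column[OF assms(1)])
  qed simp
  then show ?thesis using assms(3) by (simp add: gap_def)
qed

lemma gap_notin_beads: "young_diagram D \<Longrightarrow> 1 \<le> b \<Longrightarrow> gap D b \<notin> beads D"
  using gap_neq_bead[of D] by (auto simp: beads_def)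

text \<open>Let \<open>a\<close> be the first row whose bead is below \<open>p\<close>. The rows
  above it reach column \<open>p + a\<close> and row \<open>a\<close> does not, so that column has
  length \<open>a - 1\<close> and its gap is \<open>p\<close>.\<close>

lemma obtain_gap:
  assumes "young_diagram D" and "p \<notin> beads D"
  obtains b where "1 \<le> b" and "gap D b = p"
proof -
  let ?P = "\<lambda>a. 1 \<le> a \<and> bead D a < p"
  \<comment> \<open>No row is longer than the first, so the beads of sufficiently low rows fall
    below \<open>p\<close>.\<close>
  have "bead D a < p" if "a > row_length D 1 + nat \<bar>p\<bar> + 1" for a
  proof -
    have "row_length D a \<le> row_length D 1"
      using that young_diagramD(4)[OF assms(1)]
        mem_iff_row[OF assms(1), of a "row_length D a"] mem_iff_row[OF assms(1), of 1 "row_length D a"]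
      by (cases "row_length D a = 0") (auto intro: order.trans)
    then show ?thesis using that by (simp add: bead_def)
  qed
  then have "\<exists>a. ?P a" by (intro exI[of _ "row_length D 1 + nat \<bar>p\<bar> + 2"]) simp
  define a where "a = (LEAST a. ?P a)"
  have a: "1 \<le> a" "bead D a < p" using LeastI_ex[OF \<open>\<exists>a. ?P a\<close>] by (simp_all add: a_def)
  have above: "p < bead D c" if "1 \<le> c" "c < a" for c
  proof -
    have "\<not> bead D c < p" using not_less_Least[of c ?P] that by (simp add: a_def)
    moreover have "bead D c \<noteq> p" using assms(2) that by (auto simp: beads_def)
    ultimately show ?thesis by simp
  qed
  \<comment> \<open>Solving \<open>b - 1 - (a - 1) = p\<close> for the column.\<close>
  define b where "b = nat (p + int a)"
  have b: "int b = p + int a" "1 \<le> b" "row_length D a < b" using a by (auto simp: b_def bead_def)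
  have "column_length D b = a - 1"
  proof (cases "a = 1")
    case True
    then have "(1, b) \<notin> D" using b by (simp add: mem_iff_row[OF assms(1)])
    then show ?thesis using True by (simp add: mem_iff_column[OF assms(1)])
  next
    case False
    then have "p < bead D (a - 1)" using above a by simp
    then have "(a - 1, b) \<in> D" using b a False by (simp add: mem_iff_row[OF assms(1)] bead_def)
    moreover have "(a, b) \<notin> D" using b by (simp add: mem_iff_row[OF assms(1)])
    ultimately show ?thesis using a unfolding mem_iff_column[OF assms(1)] by linarith
  qed
  then have "gap D b = p" using b a by (simp add: gap_def)
  then show thesis using that b by blast
qed

section \<open>Addable and removable boxes as adjacent bead and gap\<close>

lemma addable_lengths:
  assumes "young_diagram D" and "(a, b) \<in> addable_boxes l i D"
  shows "bead D a = content (a, b) - 1" and "gap D b = content (a, b)"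
proof -
  note ab = assms(2)[unfolded mem_addable_iff[OF assms(1)]]
  have "row_length D a = b - 1"
    using ab mem_iff_row[OF assms(1), of a b] mem_iff_row[OF assms(1), of a "b - 1"] by linarith
  moreover have "column_length D b = a - 1"
    using ab mem_iff_column[OF assms(1), of a b] mem_iff_column[OF assms(1), of "a - 1" b]
    by linarith
  ultimately show "bead D a = content (a, b) - 1" and "gap D b = content (a, b)"
    using ab by (simp_all add: bead_def gap_def content_def)
qed

lemma removable_lengths:
  assumes "young_diagram D" and "(a, b) \<in> removable_boxes l i D"
  shows "bead D a = content (a, b)" and "gap D b = content (a, b) - 1"
proof -
  note ab = assms(2)[unfolded mem_removable_iff[OF assms(1)]]
  have "row_length D a = b"
    using ab mem_iff_row[OF assms(1), of a b] mem_iff_row[OF assms(1), of a "Suc b"] by linarith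
  moreover have "column_length D b = a"
    using ab mem_iff_column[OF assms(1), of a b] mem_iff_column[OF assms(1), of "Suc a" b]
    by linarith
  ultimately show "bead D a = content (a, b)" and "gap D b = content (a, b) - 1"
    by (simp_all add: bead_def gap_def content_def)
qed

text \<open>Residue is content modulo \<open>l\<close>, and an addable box of content
  \<open>c\<close> is a bead at \<open>c - 1\<close> that can slide into the gap at
  \<open>c\<close>.\<close>

lemma content_addable:
  assumes "young_diagram D"
  shows "content ` addable_boxes l i D =
    {c. c mod int l = i \<and> c - 1 \<in> beads D \<and> c \<notin> beads D}" (is "_ = ?R")
proof (intro equalityI subsetI)
  fix c assume "c \<in> content ` addable_boxes l i D"
  then obtain a b where ab: "(a, b) \<in> addable_boxes l i D" "c = content (a, b)" by auto
  note m = ab(1)[unfolded mem_addable_iff[OF assms]]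
  have "c mod int l = i" using m ab(2) by (simp add: residue_def content_def)
  moreover have "c - 1 \<in> beads D"
    using addable_lengths(1)[OF assms ab(1)] ab(2) m unfolding beads_def
    by (intro image_eqI[of _ _ a]) auto
  moreover have "c \<notin> beads D"
    using addable_lengths(2)[OF assms ab(1)] ab(2) m gap_notin_beads[OF assms, of b] by simp
  ultimately show "c \<in> ?R" by simp
next
  fix c assume c: "c \<in> ?R"
  then obtain a where a: "1 \<le> a" "bead D a = c - 1" by (auto simp: beads_def)
  obtain b where b: "1 \<le> b" "gap D b = c" using obtain_gap[OF assms] c by blast
  have nin: "(a, b) \<notin> D" using mem_iff_gap_less_bead[OF assms a(1) b(1)] a b by simp
  then have le: "row_length D a < b" "column_length D b < a"
    using mem_iff_row[OF assms, of a b] mem_iff_column[OF assms, of a b] a(1) b(1) by auto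
  \<comment> \<open>Gap minus bead is 1, so
    \<open>(b - row_length D a) + (a - column_length D b) = 2\<close> with both brackets positive;
    hence both are 1.\<close>
  then have eq: "row_length D a = b - 1" "column_length D b = a - 1"
    using a(2) b(2) unfolding bead_def gap_def by linarith+
  have "(a, b - 1) \<in> D" if "b \<noteq> 1"
    using that eq b(1) unfolding mem_iff_row[OF assms] by linarith
  moreover have "(a - 1, b) \<in> D" if "a \<noteq> 1"
    using that eq a(1) unfolding mem_iff_column[OF assms] by linarith
  moreover have cont: "content (a, b) = c" using a b eq by (simp add: content_def bead_def)
  moreover have "residue l (a, b) = i" using c cont by (simp add: residue_def content_def)
  ultimately have "(a, b) \<in> addable_boxes l i D"
    using nin a(1) b(1) by (auto simp: mem_addable_iff[OF assms])
  then show "c \<in> content ` addable_boxes l i D" using cont by (auto intro: image_eqI[of _ _ "(a, b)"])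
qed

lemma content_removable:
  assumes "young_diagram D"
  shows "content ` removable_boxes l i D =
    {c. c mod int l = i \<and> c - 1 \<notin> beads D \<and> c \<in> beads D}" (is "_ = ?R")
proof (intro equalityI subsetI)
  fix c assume "c \<in> content ` removable_boxes l i D"
  then obtain a b where ab: "(a, b) \<in> removable_boxes l i D" "c = content (a, b)" by auto
  note m = ab(1)[unfolded mem_removable_iff[OF assms]]
  have 1: "1 \<le> a" "1 \<le> b" using m young_diagramD(2,3)[OF assms] by auto
  have "c mod int l = i" using m ab(2) by (simp add: residue_def content_def)
  moreover have "c \<in> beads D"
    using removable_lengths(1)[OF assms ab(1)] ab(2) 1 unfolding beads_def
    by (intro image_eqI[of _ _ a]) auto
  moreover have "c - 1 \<notin> beads D"
    using removable_lengths(2)[OF assms ab(1)] ab(2) 1 gap_notin_beads[OF assms, of b] by simp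
  ultimately show "c \<in> ?R" by simp
next
  fix c assume c: "c \<in> ?R"
  then obtain a where a: "1 \<le> a" "bead D a = c" by (auto simp: beads_def)
  obtain b where b: "1 \<le> b" "gap D b = c - 1" using obtain_gap[OF assms] c by blast
  have mem: "(a, b) \<in> D" using mem_iff_gap_less_bead[OF assms a(1) b(1)] a b by simp
  then have le: "b \<le> row_length D a" "a \<le> column_length D b"
    using mem_iff_row[OF assms, of a b] mem_iff_column[OF assms, of a b] by auto
  \<comment> \<open>The hook length is 1, so arm and leg are both empty.\<close>
  then have eq: "row_length D a = b" "column_length D b = a"
    using a(2) b(2) unfolding bead_def gap_def by linarith+
  have "(a, Suc b) \<notin> D" using eq(1) by (simp add: mem_iff_row[OF assms])
  moreover have "(Suc a, b) \<notin> D" using eq(2) by (simp add: mem_iff_column[OF assms])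
  moreover have cont: "content (a, b) = c" using a b eq by (simp add: content_def bead_def)
  moreover have "residue l (a, b) = i" using c cont by (simp add: residue_def content_def)
  ultimately have "(a, b) \<in> removable_boxes l i D"
    using mem by (auto simp: mem_removable_iff[OF assms])
  then show "c \<in> content ` removable_boxes l i D"
    using cont by (auto intro: image_eqI[of _ _ "(a, b)"])
qed

lemma beads_insert:
  assumes "young_diagram D" and "p \<in> addable_boxes l i D"
  shows "beads (insert p D) = insert (content p) (beads D - {content p - 1})"
proof -
  obtain a b where p: "p = (a, b)" by (cases p)
  have ab: "(a, b) \<in> addable_boxes l i D" using assms(2) p by simp
  have "(a, b) \<notin> D" "1 \<le> a" using ab by (simp_all add: mem_addable_iff[OF assms(1)])
  have other: "bead (insert p D) c = bead D c" if "c \<noteq> a" for c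
    using that p by (simp add: bead_def row_length_def)
  have "{y. (a, y) \<in> insert p D} = insert b {y. (a, y) \<in> D}" using p by auto
  moreover have "finite {y. (a, y) \<in> D}" by (simp add: row_eq[OF assms(1)])
  ultimately have "row_length (insert p D) a = Suc (row_length D a)"
    using \<open>(a, b) \<notin> D\<close> by (simp add: row_length_def)
  then have new: "bead (insert p D) a = content p"
    using addable_lengths(1)[OF assms(1) ab] p by (simp add: bead_def)
  have old: "bead D a = content p - 1" using addable_lengths(1)[OF assms(1) ab] p by simp
  \<comment> \<open>Different rows have different beads, so dropping row \<open>a\<close> from the
    index set drops exactly the value \<open>content p - 1\<close>.\<close>
  have inj: "c = a" if "1 \<le> c" "bead D c = bead D a" for c
    using bead_strict_decreasing[OF assms(1), of c a] bead_strict_decreasing[OF assms(1), of a c]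
      that \<open>1 \<le> a\<close> by (cases c a rule: linorder_cases) auto
  have rows: "{1..} = insert a ({1..} - {a})" using \<open>1 \<le> a\<close> by auto
  have img: "bead (insert p D) ` ({1..} - {a}) = bead D ` ({1..} - {a})"
    by (rule image_cong) (auto simp: other)
  have "beads (insert p D) = insert (content p) (bead D ` ({1..} - {a}))"
    unfolding beads_def by (subst rows, subst image_insert) (simp only: new img)
  also have "bead D ` ({1..} - {a}) = beads D - {content p - 1}"
    unfolding beads_def using inj old[symmetric] by auto
  finally show ?thesis .
qed

lemma beads_remove:
  assumes "2 \<le> l" and "young_diagram D" and "p \<in> removable_boxes l i D"
  shows "beads (D - {p}) = insert (content p - 1) (beads D - {content p})"
proof -
  have p: "insert p (D - {p}) = D" "young_diagram (D - {p})"
    using assms(3) by (auto simp: removable_boxes_def)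
  have add: "p \<in> addable_boxes l i (D - {p})" by (rule mem_addable_remove[OF assms])
  have "content p - 1 \<in> beads (D - {p})" "content p \<notin> beads (D - {p})"
    using content_addable[OF p(2), of l i] add by blast+
  then show ?thesis using beads_insert[OF p(2) add] p(1) by auto
qed

section \<open>Iterating the crystal operators\<close>

text \<open>The defining recursion splits off the last application; the inductions below change the
  starting diagram and need the first one split off.\<close>

lemma iterate_partial_Suc:
  "iterate_partial g (Suc n) x = Option.bind (g x) (iterate_partial g n)"
proof (induction n)
  case 0
  show ?case by (cases "g x") auto
next
  case (Suc n)
  have "iterate_partial g (Suc (Suc n)) x = Option.bind (iterate_partial g (Suc n) x) g" by simp
  also have "\<dots> = Option.bind (g x) (iterate_partial g (Suc n))"
    unfolding Suc.IH by (cases "g x") auto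
  finally show ?case .
qed

text \<open>The signature already has the form \<open>+...+-...-\<close>, so reduction leaves it
  unchanged.\<close>

lemma reduced_no_cancellation:
  assumes "ladder_reading l (addable_boxes l i D \<union> removable_boxes l i D) = ps @ ms"
    and "set ps = addable_boxes l i D" and "set ms = removable_boxes l i D"
  shows "conormal_boxes l i D = ps" and "normal_boxes l i D = ms"
proof -
  have disj: "p \<notin> addable_boxes l i D" if "p \<in> set ms" for p
    using that assms(3) by (auto simp: addable_boxes_def removable_boxes_def)
  have "ladder_signature l i D = map (Pair Plus) ps @ map (Pair Minus) ms"
    unfolding ladder_signature_def assms(1) using assms(2) disj by auto
  then have "reduced (ladder_signature l i D) = map (Pair Plus) ps @ map (Pair Minus) ms"
    by (simp add: reduced_eq_cancel cancel_Plus_Minus)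
  then show "conormal_boxes l i D = ps" and "normal_boxes l i D = ms"
    by (simp_all add: conormal_boxes_def normal_boxes_def filter_map o_def)
qed

text \<open>The cogood box is the last entry of \<open>ps\<close>. After it is added the reading is
  the same list, but this box now heads the removable part. The hypotheses thus persist with
  \<open>p # ms\<close>, and induction from the right end of \<open>ps\<close> adds every
  box.\<close>

lemma iterate_f_hat:
  assumes "2 \<le> l" and "young_diagram D"
    and "ladder_reading l (addable_boxes l i D \<union> removable_boxes l i D) = ps @ ms"
    and "distinct (ps @ ms)"
    and "set ps = addable_boxes l i D" and "set ms = removable_boxes l i D"
  shows "\<exists>E. iterate_partial (f_hat l i) (length ps) D = Some E \<and> young_diagram E \<and>
    beads E = (beads D - (\<lambda>p. content p - 1) ` set ps) \<union> content ` set ps"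
  using assms
proof (induction ps arbitrary: D ms rule: rev_induct)
  case Nil
  then show ?case by simp
next
  case (snoc p ps)
  have p: "p \<in> addable_boxes l i D" using snoc.prems(5) by auto
  then have Y: "young_diagram (insert p D)" by (simp add: addable_boxes_def)
  note add = addable_insert[OF snoc.prems(1,2) p]
  note rem = removable_insert[OF snoc.prems(1,2) p]
  have "conormal_boxes l i D = ps @ [p]"
    using reduced_no_cancellation[OF snoc.prems(3,5,6)] by simp
  then have f: "f_hat l i D = Some (insert p D)" by (simp add: f_hat_def)
  have set_ps: "set ps = addable_boxes l i (insert p D)" using snoc.prems(4,5) add by auto
  have "addable_boxes l i (insert p D) \<union> removable_boxes l i (insert p D) =
      addable_boxes l i D \<union> removable_boxes l i D"
    using p add rem by auto
  then obtain E where E: "iterate_partial (f_hat l i) (length ps) (insert p D) = Some E"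
    "young_diagram E"
    "beads E = (beads (insert p D) - (\<lambda>p. content p - 1) ` set ps) \<union> content ` set ps"
    using snoc.IH[OF snoc.prems(1) Y, of "p # ms"] snoc.prems rem set_ps by auto
  \<comment> \<open>Slides start at beads of \<open>D\<close> and end at gaps of \<open>D\<close>,
    so no slide starts where another ends and all may be performed at once.\<close>
  have X: "content q - 1 \<in> beads D" "content q \<notin> beads D" if "q \<in> set (ps @ [p])" for q
    using content_addable[OF snoc.prems(2), of l i] that unfolding snoc.prems(5) by blast+
  have "content p - 1 \<notin> content ` set (ps @ [p])"
    using X(1)[of p] X(2) by auto
  moreover have "content p \<notin> (\<lambda>p. content p - 1) ` set ps"
    using X(2)[of p] X(1) by auto
  ultimately have "beads E = (beads D - (\<lambda>p. content p - 1) ` set (ps @ [p])) \<union> content ` set (ps @ [p])"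
    unfolding E(3) beads_insert[OF snoc.prems(2) p] by auto
  then show ?case using E f by (simp del: iterate_partial.simps add: iterate_partial_Suc)
qed

text \<open>The good box is the head of \<open>ms\<close>; once removed, it becomes the last addable
  box of the unchanged reading, so the induction runs from the left.\<close>

lemma iterate_e_hat:
  assumes "2 \<le> l" and "young_diagram D"
    and "ladder_reading l (addable_boxes l i D \<union> removable_boxes l i D) = ps @ ms"
    and "distinct (ps @ ms)"
    and "set ps = addable_boxes l i D" and "set ms = removable_boxes l i D"
  shows "\<exists>E. iterate_partial (e_hat l i) (length ms) D = Some E \<and> young_diagram E \<and>
    beads E = (beads D - content ` set ms) \<union> (\<lambda>p. content p - 1) ` set ms"
  using assms
proof (induction ms arbitrary: D ps)
  case Nil
  then show ?case by simp
next
  case (Cons p ms)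
  have p: "p \<in> removable_boxes l i D" using Cons.prems(6) by auto
  then have Y: "young_diagram (D - {p})" by (simp add: removable_boxes_def)
  note add = addable_remove[OF Cons.prems(1,2) p]
  note rem = removable_remove[OF Cons.prems(1,2) p]
  have "normal_boxes l i D = p # ms"
    using reduced_no_cancellation[OF Cons.prems(3,5,6)] by simp
  then have e: "e_hat l i D = Some (D - {p})" by (simp add: e_hat_def)
  have set_ms: "set ms = removable_boxes l i (D - {p})" using Cons.prems(4,6) rem by auto
  have "addable_boxes l i (D - {p}) \<union> removable_boxes l i (D - {p}) =
      addable_boxes l i D \<union> removable_boxes l i D"
    using p add rem by auto
  then obtain E where E: "iterate_partial (e_hat l i) (length ms) (D - {p}) = Some E"
    "young_diagram E"
    "beads E = (beads (D - {p}) - content ` set ms) \<union> (\<lambda>p. content p - 1) ` set ms"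
    using Cons.IH[OF Cons.prems(1) Y, of "ps @ [p]"] Cons.prems add set_ms by auto
  have X: "content q - 1 \<notin> beads D" "content q \<in> beads D" if "q \<in> set (p # ms)" for q
    using content_removable[OF Cons.prems(2), of l i] that unfolding Cons.prems(6) by blast+
  have "content p - 1 \<notin> content ` set (p # ms)"
    using X(1)[of p] X(2) by (metis imageE list.set_intros(1))
  moreover have "content p \<notin> (\<lambda>p. content p - 1) ` set ms"
    using X(2)[of p] X(1) by (metis (no_types, lifting) imageE list.set_intros)
  ultimately have "beads E = (beads D - content ` set (p # ms)) \<union> (\<lambda>p. content p - 1) ` set (p # ms)"
    unfolding E(3) beads_remove[OF Cons.prems(1,2) p] by auto
  then show ?case using E e by (simp del: iterate_partial.simps add: iterate_partial_Suc)
qed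

section \<open>The JM condition on an abacus\<close>

text \<open>\<open>r\<close> names the runner of a position. It is kept abstract because the
  exchange arguments below use only how runners behave under a shift by one. The box is
  \<open>(x, y)\<close>; \<open>y'\<close> marks another box of its row, \<open>x'\<close> another
  box of its column.\<close>

definition JM_abacus :: "(int \<Rightarrow> 'a) \<Rightarrow> int set \<Rightarrow> bool" where
  "JM_abacus r X \<longleftrightarrow> \<not> (\<exists>x y x' y'. x \<in> X \<and> y \<notin> X \<and> y < x \<and> r x = r y \<and>
     y' \<notin> X \<and> y' < x \<and> r y' \<noteq> r x \<and> x' \<in> X \<and> y < x' \<and> r x' \<noteq> r y)"

lemma JM_abacusD:
  assumes "JM_abacus r X" "x \<in> X" "y \<notin> X" "y < x" "r x = r y"
    and "y' \<notin> X" "y' < x" "r y' \<noteq> r x" "x' \<in> X" "y < x'" "r x' \<noteq> r y"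
  shows False
  using assms unfolding JM_abacus_def by blast

text \<open>Rows are beads, columns are gaps, boxes are pairs with gap below bead, and a hook length
  is their difference, so the quantifiers translate one by one.\<close>

lemma JM_partition_iff_abacus:
  "JM_partition l D \<longleftrightarrow> young_diagram D \<and> JM_abacus (\<lambda>x. x mod int l) (beads D)"
proof (cases "young_diagram D")
  case True
  have dvd: "l dvd hook_length D (a, b) \<longleftrightarrow> bead D a mod int l = gap D b mod int l"
    if "(a, b) \<in> D" for a b
    using hook_length_eq[OF True that] by (metis int_dvd_int_iff mod_eq_dvd_iff)
  have "JM_partition l D \<longleftrightarrow> \<not> (\<exists>a b x y. (a, b) \<in> D \<and> (a, y) \<in> D \<and> (x, b) \<in> D \<and>
      bead D a mod int l = gap D b mod int l \<and> bead D a mod int l \<noteq> gap D y mod int l \<and>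
      bead D x mod int l \<noteq> gap D b mod int l)"
    unfolding JM_partition_def using True
    by (simp only: simp_thms, intro arg_cong[where f = Not] ex_cong1) (auto simp: dvd)
  also have "\<dots> \<longleftrightarrow> JM_abacus (\<lambda>x. x mod int l) (beads D)"
    unfolding JM_abacus_def
  proof (rule arg_cong[where f = Not], rule iffI; elim exE conjE)
    fix a b x y
    assume *: "(a, b) \<in> D" "(a, y) \<in> D" "(x, b) \<in> D"
      "bead D a mod int l = gap D b mod int l" "bead D a mod int l \<noteq> gap D y mod int l"
      "bead D x mod int l \<noteq> gap D b mod int l"
    have 1: "1 \<le> a" "1 \<le> b" "1 \<le> x" "1 \<le> y" using * young_diagramD(2,3)[OF True] by blast+
    then have "bead D a \<in> beads D" "bead D x \<in> beads D" by (simp_all add: beads_def)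
    then show "\<exists>x y x' y'. x \<in> beads D \<and> y \<notin> beads D \<and> y < x \<and> x mod int l = y mod int l \<and>
        y' \<notin> beads D \<and> y' < x \<and> y' mod int l \<noteq> x mod int l \<and>
        x' \<in> beads D \<and> y < x' \<and> x' mod int l \<noteq> y mod int l"
      using * 1 gap_notin_beads[OF True] mem_iff_gap_less_bead[OF True]
      by (intro exI[of _ "bead D a"] exI[of _ "gap D b"] exI[of _ "bead D x"] exI[of _ "gap D y"]) auto
  next
    fix x y x' y'
    assume *: "x \<in> beads D" "y \<notin> beads D" "y < x" "x mod int l = y mod int l"
      "y' \<notin> beads D" "y' < x" "y' mod int l \<noteq> x mod int l"
      "x' \<in> beads D" "y < x'" "x' mod int l \<noteq> y mod int l"
    obtain a c where "1 \<le> a" "bead D a = x" "1 \<le> c" "bead D c = x'" using * by (auto simp: beads_def)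
    moreover obtain b where "1 \<le> b" "gap D b = y" using obtain_gap[OF True] *(2) by blast
    moreover obtain d where "1 \<le> d" "gap D d = y'" using obtain_gap[OF True] *(5) by blast
    ultimately show "\<exists>a b x y. (a, b) \<in> D \<and> (a, y) \<in> D \<and> (x, b) \<in> D \<and>
      bead D a mod int l = gap D b mod int l \<and> bead D a mod int l \<noteq> gap D y mod int l \<and>
      bead D x mod int l \<noteq> gap D b mod int l"
      using * mem_iff_gap_less_bead[OF True]
      by (intro exI[of _ a] exI[of _ b] exI[of _ d] exI[of _ c]) auto
  qed
  finally show ?thesis using True by simp
qed (simp add: JM_partition_def)

text \<open>\<open>X'\<close> has the union on runner \<open>c\<close> and the intersection on the
  runner before it. By \<open>succ\<close> a shift by one maps runners to runners, by
  \<open>ne\<close> it moves each of them. A violation is pulled back according to the runner of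
  \<open>x\<close> and \<open>y\<close>.\<close>

lemma JM_abacus_add:
  assumes succ: "\<And>x y. r (x + 1) = r (y + 1) \<longleftrightarrow> r x = r y"
    and ne: "\<And>x. r (x + 1) \<noteq> r x"
    and J: "JM_abacus r X"
    and X': "\<And>p. p \<in> X' \<longleftrightarrow> (if r p = c then p \<in> X \<or> p - 1 \<in> X
                else if r (p + 1) = c then p \<in> X \<and> p + 1 \<in> X else p \<in> X)"
  shows "JM_abacus r X'"
  unfolding JM_abacus_def
proof (rule notI, elim exE conjE)
  fix x y x' y'
  assume *: "x \<in> X'" "y \<notin> X'" "y < x" "r x = r y" "y' \<notin> X'" "y' < x" "r y' \<noteq> r x"
    "x' \<in> X'" "y < x'" "r x' \<noteq> r y"
  have succ': "r (x - 1) = r (y - 1) \<longleftrightarrow> r x = r y" for x y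
    using succ[of "x - 1" "y - 1"] by simp
  have ne': "r (x - 1) \<noteq> r x" for x
    using ne[of "x - 1"] by (metis diff_add_cancel)
  consider (i) "r x = c" | (pred) "r (x + 1) = c" | (other) "r x \<noteq> c" "r (x + 1) \<noteq> c" by blast
  then show False
  proof cases
    case i
    \<comment> \<open>A missing bead on runner \<open>c\<close> yields two gaps \<open>y\<close> and
      \<open>y - 1\<close> of \<open>X\<close>. If \<open>x\<close> is a bead, \<open>(x, y)\<close>
      violates with second gap \<open>y - 1\<close>; otherwise \<open>(x - 1, y - 1)\<close> does
      with second gap \<open>y\<close>.\<close>
    have y: "y \<notin> X" "y - 1 \<notin> X" using * i X'[of y] by auto
    show False
    proof (cases "x \<in> X")
      case True
      have "x' \<in> X" using * i X'[of x'] by (auto split: if_splits)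
      then show False
        using JM_abacusD[OF J True y(1), of "y - 1" x'] * y ne'[of y] by auto
    next
      case False
      then have x: "x - 1 \<in> X" using * i X'[of x] by auto
      have r: "r (x - 1) = r (y - 1)" using * succ' by simp
      have "y \<noteq> x - 1" using * ne' by metis
      then have yx: "y < x - 1" using * by linarith
      \<comment> \<open>On the runner of \<open>y - 1\<close> the intersection makes
        \<open>x' + 1\<close> a bead too, and this one is on runner \<open>c\<close>.\<close>
      obtain z where "z \<in> X" "y - 1 < z" "r z \<noteq> r (y - 1)"
      proof (cases "r x' = r (y - 1)")
        case True
        then have "r (x' + 1) = c" using * i succ'[of "x' + 1" y] by simp
        then have "x' + 1 \<in> X" using * i X'[of x'] by (auto split: if_splits)
        then show thesis using that[of "x' + 1"] * True ne[of x'] by auto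
      next
        case False
        then have "x' \<in> X" using * i X'[of x'] by (auto split: if_splits)
        then show thesis using that[of x'] * False by auto
      qed
      then show False
        using JM_abacusD[OF J x y(2), of y z] * yx y r ne'[of y] by auto
    qed
  next
    case pred
    have c: "r x \<noteq> c" "r y \<noteq> c" "r (y + 1) = c" using pred ne[of x] * succ[of x y] by auto
    \<comment> \<open>A bead on the runner before \<open>c\<close> yields two beads \<open>x\<close>
      and \<open>x + 1\<close> of \<open>X\<close>. If \<open>y\<close> is a gap,
      \<open>(x, y)\<close> violates with second bead \<open>x + 1\<close>; otherwise
      \<open>(x + 1, y + 1)\<close> does with second bead \<open>x\<close>.\<close>
    have x: "x \<in> X" "x + 1 \<in> X" using * c pred X'[of x] by auto
    show False
    proof (cases "y \<in> X")
      case False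
      have "y' \<notin> X"
        using * c X'[of y'] succ[of y' x] pred by (auto split: if_splits)
      then show False
        using JM_abacusD[OF J x(1) False, of y' "x + 1"] * x ne[of x] by auto
    next
      case True
      then have y: "y + 1 \<notin> X" using * c X'[of y] by auto
      have r: "r (x + 1) = r (y + 1)" using * succ by simp
      have "x \<noteq> y + 1" using * ne by metis
      then have yx: "y + 1 < x" using * by linarith
      obtain z where "z \<notin> X" "z < x + 1" "r z \<noteq> r (x + 1)"
      proof (cases "r y' = c")
        case True
        then have "y' - 1 \<notin> X" using * X'[of y'] by auto
        then show thesis using that[of "y' - 1"] * True pred ne'[of y'] by auto
      next
        case False
        then have "y' \<notin> X" using * X'[of y'] succ[of y' x] pred by (auto split: if_splits)
        then show thesis using that[of y'] * False pred by auto
      qed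
      then show False
        using JM_abacusD[OF J x(2) y, of z x] * yx x r ne[of x] by auto
    qed
  next
    case other
    have c: "r y \<noteq> c" "r (y + 1) \<noteq> c" using other * succ[of x y] by auto
    have xy: "x \<in> X" "y \<notin> X" using * other c X'[of x] X'[of y] by auto
    \<comment> \<open>Here \<open>x\<close> and \<open>y\<close> are unaffected. Only the witnesses
      may have to move: a gap \<open>y'\<close> of \<open>X'\<close> filled in \<open>X\<close>
      gives the gap \<open>y' + 1\<close>, a bead \<open>x'\<close> missing in \<open>X\<close>
      gives the bead \<open>x' - 1\<close>.\<close>
    obtain z where z: "z \<notin> X" "z < x" "r z \<noteq> r x"
    proof (cases "y' \<in> X")
      case True
      then have "r (y' + 1) = c" "y' + 1 \<notin> X" using * X'[of y'] by (auto split: if_splits)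
      moreover have "y' + 1 \<noteq> x" using other \<open>r (y' + 1) = c\<close> by auto
      ultimately show thesis using that[of "y' + 1"] * other by auto
    qed (use that[of y'] * in auto)
    obtain w where w: "w \<in> X" "y < w" "r w \<noteq> r y"
    proof (cases "x' \<in> X")
      case False
      then have "r x' = c" "x' - 1 \<in> X" using * X'[of x'] by (auto split: if_splits)
      moreover have "x' - 1 \<noteq> y" using c \<open>r x' = c\<close> by auto
      moreover have "r (x' - 1) \<noteq> r y" using c \<open>r x' = c\<close> succ[of "x' - 1" y] by auto
      ultimately show thesis using that[of "x' - 1"] * by auto
    qed (use that[of x'] * in auto)
    show False using JM_abacusD[OF J xy, of z w] z w * by blast
  qed
qed

text \<open>Union and intersection trade places, so the spare bead now arises on runner
  \<open>c\<close> and the spare gap on the runner before it.\<close>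

lemma JM_abacus_remove:
  assumes succ: "\<And>x y. r (x + 1) = r (y + 1) \<longleftrightarrow> r x = r y"
    and ne: "\<And>x. r (x + 1) \<noteq> r x"
    and J: "JM_abacus r X"
    and X': "\<And>p. p \<in> X' \<longleftrightarrow> (if r p = c then p \<in> X \<and> p - 1 \<in> X
                else if r (p + 1) = c then p \<in> X \<or> p + 1 \<in> X else p \<in> X)"
  shows "JM_abacus r X'"
  unfolding JM_abacus_def
proof (rule notI, elim exE conjE)
  fix x y x' y'
  assume *: "x \<in> X'" "y \<notin> X'" "y < x" "r x = r y" "y' \<notin> X'" "y' < x" "r y' \<noteq> r x"
    "x' \<in> X'" "y < x'" "r x' \<noteq> r y"
  have succ': "r (x - 1) = r (y - 1) \<longleftrightarrow> r x = r y" for x y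
    using succ[of "x - 1" "y - 1"] by simp
  have ne': "r (x - 1) \<noteq> r x" for x
    using ne[of "x - 1"] by (metis diff_add_cancel)
  consider (i) "r x = c" | (pred) "r (x + 1) = c" | (other) "r x \<noteq> c" "r (x + 1) \<noteq> c" by blast
  then show False
  proof cases
    case i
    \<comment> \<open>Both \<open>x\<close> and \<open>x - 1\<close> are beads of \<open>X\<close>:
      one forms the violating pair, with \<open>y\<close> or \<open>y - 1\<close>, and the other is
      the second bead.\<close>
    have x: "x \<in> X" "x - 1 \<in> X" using * i X'[of x] by auto
    have "y \<noteq> x - 1" using * ne' by metis
    then have yx: "y < x - 1" using * by linarith
    have y': "y' \<notin> X" using * i X'[of y'] by (auto split: if_splits)
    show False
    proof (cases "y \<in> X")
      case False
      then show False
        using JM_abacusD[OF J x(1) False, of y' "x - 1"] * x yx y' ne'[of x] by auto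
    next
      case True
      then have y: "y - 1 \<notin> X" using * i X'[of y] by auto
      have r: "r (x - 1) = r (y - 1)" using * succ' by simp
      \<comment> \<open>The second gap must stay below \<open>x - 1\<close>, not only below
        \<open>x\<close>; it cannot equal \<open>x - 1\<close> or \<open>x\<close>, since these are
        beads.\<close>
      obtain z where "z \<notin> X" "z < x - 1" "r z \<noteq> r (x - 1)"
      proof (cases "r (y' + 1) = c")
        case True
        then have "y' + 1 \<notin> X" using * i X'[of y'] by auto
        moreover from this have "y' + 1 \<noteq> x" using x by auto
        moreover from \<open>y' + 1 \<notin> X\<close> have "y' + 1 \<noteq> x - 1" using x by metis
        ultimately show thesis
          using that[of "y' + 1"] * True i ne'[of x] by auto
      next
        case False
        have "y' \<noteq> x - 1" using x y' by auto
        moreover have "r y' \<noteq> r (x - 1)" using False i succ'[of "y' + 1" x] by auto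
        ultimately show thesis using that[of y'] * y' by auto
      qed
      then show False
        using JM_abacusD[OF J x(2) y, of z x] * yx x r ne'[of x] by auto
    qed
  next
    case pred
    have c: "r x \<noteq> c" "r y \<noteq> c" "r (y + 1) = c" using pred ne[of x] * succ[of x y] by auto
    \<comment> \<open>Both \<open>y\<close> and \<open>y + 1\<close> are gaps of \<open>X\<close>:
      one forms the violating pair, with \<open>x\<close> or \<open>x + 1\<close>, and the other is
      the second gap.\<close>
    have y: "y \<notin> X" "y + 1 \<notin> X" using * c X'[of y] by auto
    have "x \<noteq> y + 1" using * ne by metis
    then have yx: "y + 1 < x" using * by linarith
    have x': "x' \<in> X" using * c X'[of x'] succ[of x' y] by (auto split: if_splits)
    show False
    proof (cases "x \<in> X")
      case True
      then show False
        using JM_abacusD[OF J True y(1), of "y + 1" x'] * y yx x' ne[of y] by auto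
    next
      case False
      then have x: "x + 1 \<in> X" using * c pred X'[of x] by auto
      have r: "r (x + 1) = r (y + 1)" using * succ by simp
      obtain z where "z \<in> X" "y + 1 < z" "r z \<noteq> r (y + 1)"
      proof (cases "r x' = c")
        case True
        then have "x' - 1 \<in> X" using * X'[of x'] by auto
        moreover from this have "x' - 1 \<noteq> y" "x' - 1 \<noteq> y + 1" using y by metis+
        ultimately show thesis using that[of "x' - 1"] * True c ne'[of x'] by auto
      next
        case False
        have "x' \<noteq> y + 1" using x' y by auto
        then show thesis using that[of x'] * x' False c by auto
      qed
      then show False
        using JM_abacusD[OF J x y(2), of y z] * yx y r ne[of y] by auto
    qed
  next
    case other
    have c: "r y \<noteq> c" "r (y + 1) \<noteq> c" using other * succ[of x y] by auto
    have xy: "x \<in> X" "y \<notin> X" using * other c X'[of x] X'[of y] by auto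
    obtain z where z: "z \<notin> X" "z < x" "r z \<noteq> r x"
    proof (cases "y' \<in> X")
      case True
      then have "r y' = c" "y' - 1 \<notin> X" using * X'[of y'] by (auto split: if_splits)
      moreover have "r (y' - 1) \<noteq> r x" using other \<open>r y' = c\<close> succ[of "y' - 1" x] by auto
      ultimately show thesis using that[of "y' - 1"] * by auto
    qed (use that[of y'] * in auto)
    obtain w where w: "w \<in> X" "y < w" "r w \<noteq> r y"
    proof (cases "x' \<in> X")
      case False
      then have "r (x' + 1) = c" "x' + 1 \<in> X" using * X'[of x'] by (auto split: if_splits)
      then show thesis using that[of "x' + 1"] * c by auto
    qed (use that[of x'] * in auto)
    show False using JM_abacusD[OF J xy, of z w] z w * by blast
  qed
qed

section \<open>Ladder order of addable and removable boxes\<close>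

text \<open>Beads of consecutive rows are distinct and congruent modulo \<open>l\<close>, so each
  row costs at least \<open>l\<close>.\<close>

lemma bead_drop:
  assumes "young_diagram D" and "1 \<le> a" and "a \<le> a'"
    and "\<And>x. a \<le> x \<Longrightarrow> x \<le> a' \<Longrightarrow> int l dvd bead D x - p"
  shows "bead D a' + int l * int (a' - a) \<le> bead D a"
  using assms(3,4)
proof (induction a' rule: dec_induct)
  case (step n)
  have "bead D (Suc n) < bead D n" using bead_strict_decreasing[OF assms(1)] assms(2) step by simp
  moreover have "int l dvd bead D n - bead D (Suc n)"
    using step.prems[of n] step.prems[of "Suc n"] step.hyps dvd_diff[of "int l" "bead D n - p" "bead D (Suc n) - p"]
    by simp
  ultimately have "bead D (Suc n) + int l \<le> bead D n" using zdvd_imp_le by fastforce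
  moreover have "bead D n + int l * int (n - a) \<le> bead D a" using step by simp
  moreover have "int (Suc n - a) = int (n - a) + 1" using step.hyps by simp
  ultimately show ?case by (simp add: distrib_left)
qed simp

lemma gap_rise:
  assumes "young_diagram D" and "1 \<le> b" and "b \<le> b'"
    and "\<And>x. b \<le> x \<Longrightarrow> x \<le> b' \<Longrightarrow> int l dvd gap D x - p"
  shows "gap D b + int l * int (b' - b) \<le> gap D b'"
  using assms(3,4)
proof (induction b' rule: dec_induct)
  case (step n)
  have "gap D n < gap D (Suc n)" using gap_strict_increasing[OF assms(1)] assms(2) step by simp
  moreover have "int l dvd gap D (Suc n) - gap D n"
    using step.prems[of n] step.prems[of "Suc n"] step.hyps dvd_diff[of "int l" "gap D (Suc n) - p" "gap D n - p"]
    by simp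
  ultimately have "gap D n + int l \<le> gap D (Suc n)" using zdvd_imp_le by fastforce
  moreover have "gap D b + int l * int (n - b) \<le> gap D n" using step by simp
  moreover have "int (Suc n - b) = int (n - b) + 1" using step.hyps by simp
  ultimately show ?case by (simp add: distrib_left)
qed simp

text \<open>If the removable box is the upper right one, the JM condition puts all beads strictly between the
  two boxes on one runner, so they are at least \<open>l\<close> apart and the step from one box to the other is at
  least \<open>l - 1\<close> times as wide as high. If it is the lower left one, the same holds for gaps and the step
  is at least \<open>l - 1\<close> times as high as wide.\<close>

lemma ladder_less_addable_removable:
  assumes "3 \<le> l" and "JM_partition l D"
    and "p \<in> addable_boxes l i D" and "q \<in> removable_boxes l i D"
  shows "ladder_less l p q"
proof -
  have Y: "young_diagram D" using assms(2) by (simp add: JM_partition_def)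
  obtain a' b' a b where pq: "p = (a', b')" "q = (a, b)" by (cases p; cases q)
  have add: "(a', b') \<in> addable_boxes l i D" and rem: "(a, b) \<in> removable_boxes l i D"
    using assms(3,4) pq by auto
  note m = add[unfolded mem_addable_iff[OF Y]] rem[unfolded mem_removable_iff[OF Y]]
  have 1: "1 \<le> a" "1 \<le> b" "1 \<le> a'" "1 \<le> b'" using m young_diagramD(2,3)[OF Y] by blast+
  note P = addable_lengths[OF Y add] and Q = removable_lengths[OF Y rem]
  have "residue l (a', b') = residue l (a, b)" using m by simp
  then have dvd: "int l dvd content (a', b') - content (a, b)"
    by (simp add: residue_eq_iff content_def)
  have hook: "l dvd hook_length D (c, d) \<longleftrightarrow> int l dvd bead D c - gap D d" if "(c, d) \<in> D" for c d
    using hook_length_eq[OF Y that] by (metis int_dvd_int_iff)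
  \<comment> \<open>A removable box has hook length 1. It is the indivisible hook with which the JM
    condition forces divisibility elsewhere.\<close>
  have ab: "(a, b) \<in> D" "\<not> l dvd hook_length D (a, b)"
    using m hook[of a b] Q assms(1) by (simp_all add: zdvd1_eq)
  have no: "l dvd hook_length D (c, y) \<or> l dvd hook_length D (x, d)"
    if "(c, d) \<in> D" "(c, y) \<in> D" "(x, d) \<in> D" "l dvd hook_length D (c, d)" for c d x y
    using assms(2) that unfolding JM_partition_def by blast
  have "content (a', b') \<noteq> content (a, b)" using gap_neq_bead[OF Y, of a b'] P Q 1 by auto
  then consider (lower) "content (a', b') < content (a, b)" | (upper) "content (a, b) < content (a', b')"
    by linarith
  then show ?thesis
  proof cases
    case lower
    then have mem: "(a, b') \<in> D" using mem_iff_gap_less_bead[OF Y, of a b'] P Q 1 by simp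
    have "l dvd hook_length D (a, b')"
      using hook[OF mem] P Q dvd by (simp add: dvd_diff_commute)
    \<comment> \<open>The corner \<open>(a, b')\<close> has divisible hook and shares its row with
      the removable box, so every hook in column \<open>b'\<close> is divisible.\<close>
    then have col: "int l dvd bead D x - content (a', b')" if "(x, b') \<in> D" for x
      using no[OF mem ab(1) that] ab(2) hook[OF that] P by simp
    have aa': "a < a'" "(a' - 1, b') \<in> D"
    proof -
      have "\<not> a' \<le> a" using young_diagramD(4)[OF Y mem, of a' b'] m(1) 1 by blast
      then show "a < a'" by simp
      then show "(a' - 1, b') \<in> D" using m(1) 1 by auto
    qed
    have "bead D (a' - 1) + int l * int (a' - 1 - a) \<le> bead D a"
    proof (rule bead_drop[OF Y])
      fix x assume "a \<le> x" "x \<le> a' - 1"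
      then have "(x, b') \<in> D" using young_diagramD(4)[OF Y aa'(2), of x b'] 1 by simp
      then show "int l dvd bead D x - content (a', b')" by (rule col)
    qed (use 1 aa' in auto)
    \<comment> \<open>Row \<open>a'\<close> has no box in column \<open>b'\<close>, so the chain of
      beads stops at row \<open>a' - 1\<close>; the last step of size \<open>l\<close> leads from
      that bead to the gap of column \<open>b'\<close>.\<close>
    moreover have "content (a', b') + int l \<le> bead D (a' - 1)"
    proof -
      have "gap D b' < bead D (a' - 1)"
        using mem_iff_gap_less_bead[OF Y, of "a' - 1" b'] aa' 1 by simp
      then show ?thesis using col[OF aa'(2)] P zdvd_imp_le by fastforce
    qed
    moreover have "int l * int (a' - 1 - a) = int l * (int a' - int a) - int l"
      using aa' by (simp add: of_nat_diff algebra_simps)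
    ultimately have le: "int l * (int a' - int a) \<le> (int b - int a) - (int b' - int a')"
      using Q by (simp add: content_def)
    \<comment> \<open>\<open>n\<close> is the height and \<open>d\<close> the width of the step
      between the boxes. The ladder numbers differ by \<open>(l - 1) * d - n\<close>, which must be
      strictly positive, since in a tie the lower box \<open>p\<close> would be read second;
      \<open>l \<ge> 3\<close> supplies the strictness.\<close>
    define n where "n = int a' - int a"
    have n: "1 \<le> n" using aa' by (simp add: n_def)
    have k: "2 \<le> int l - 1" using assms(1) by simp
    define d where "d = int b - int b'"
    have "(int l - 1) * n \<le> d" using le by (simp add: n_def d_def algebra_simps)
    moreover have "2 * n \<le> (int l - 1) * n" using k n by (intro mult_right_mono) auto
    ultimately have dn: "2 * n \<le> d" by linarith
    have "1 * d \<le> (int l - 1) * d" using k dn n by (intro mult_right_mono) auto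
    then have "n < (int l - 1) * d" using dn n by linarith
    then have "int a' + (int l - 1) * int b' < int a + (int l - 1) * int b"
      by (simp add: n_def d_def algebra_simps)
    then have "int (ladder_number l p) < int (ladder_number l q)"
      using assms(1) pq by (simp add: ladder_number_def of_nat_diff)
    then show ?thesis by (simp add: ladder_less_def)
  next
    case upper
    then have mem: "(a', b) \<in> D" using mem_iff_gap_less_bead[OF Y, of a' b] P Q 1 by simp
    have "l dvd hook_length D (a', b)"
      using hook[OF mem] P Q dvd by simp
    then have row: "int l dvd bead D a' - gap D y" if "(a', y) \<in> D" for y
      using no[OF mem that ab(1)] ab(2) hook[OF that] P by simp
    have bb': "b < b'" "(a', b' - 1) \<in> D"
    proof -
      have "\<not> b' \<le> b" using young_diagramD(4)[OF Y mem, of a' b'] m(1) 1 by blast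
      then show "b < b'" by simp
      then show "(a', b' - 1) \<in> D" using m(1) 1 by auto
    qed
    have "gap D b + int l * int (b' - 1 - b) \<le> gap D (b' - 1)"
    proof (rule gap_rise[OF Y])
      fix y assume "b \<le> y" "y \<le> b' - 1"
      then have "(a', y) \<in> D" using young_diagramD(4)[OF Y bb'(2), of a' y] 1 by simp
      then show "int l dvd gap D y - bead D a'" using row by (simp add: dvd_diff_commute)
    qed (use 1 bb' in auto)
    moreover have "gap D (b' - 1) + int l \<le> bead D a'"
    proof -
      have "gap D (b' - 1) < bead D a'"
        using mem_iff_gap_less_bead[OF Y, of a' "b' - 1"] bb' 1 by simp
      then show ?thesis using row[OF bb'(2)] zdvd_imp_le by fastforce
    qed
    moreover have "int l * int (b' - 1 - b) = int l * (int b' - int b) - int l"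
      using bb' by (simp add: of_nat_diff algebra_simps)
    ultimately have "int l * (int b' - int b) \<le> (int b' - int a') - (int b - int a)"
      using P Q by (simp add: content_def)
    then have le: "int a' + (int l - 1) * int b' \<le> int a + (int l - 1) * int b"
      by (simp add: algebra_simps)
    then have "int (ladder_number l p) \<le> int (ladder_number l q)"
      using assms(1) pq by (simp add: ladder_number_def of_nat_diff)
    \<comment> \<open>Here the ladder numbers may coincide, and then the higher row decides. Were
      \<open>p\<close> not higher, its larger column would give it the larger ladder number.\<close>
    moreover have "a' < a"
    proof -
      have "\<not> int a \<le> int a'"
      proof
        assume "int a \<le> int a'"
        moreover have "1 * (int b' - int b) \<le> (int l - 1) * (int b' - int b)"
          using assms(1) bb' by (intro mult_right_mono) auto
        ultimately show False using le bb' by (simp add: algebra_simps)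
      qed
      then show ?thesis by simp
    qed
    ultimately show ?thesis using pq by (auto simp: ladder_less_def)
  qed
qed

section \<open>Both iterated operators on a JM partition\<close>

theorem theorem8p5:
  fixes l :: nat and i :: int and lam :: "box set"
  assumes "3 \<le> l" and "JM_partition l lam" and "0 \<le> i" and "i < int l"
  shows "(\<exists>mu. iterate_partial (f_hat l i) (phi_hat l i lam) lam = Some mu \<and> JM_partition l mu) \<and>
         (\<exists>mu. iterate_partial (e_hat l i) (epsilon_hat l i lam) lam = Some mu \<and> JM_partition l mu)"
proof -
  have l2: "2 \<le> l" using assms(1) by simp
  have Y: "young_diagram lam" using assms(2) by (simp add: JM_partition_def)
  let ?A = "addable_boxes l i lam" and ?R = "removable_boxes l i lam"
  let ?L = "ladder_reading l (?A \<union> ?R)"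
  define ps where "ps = filter (\<lambda>p. p \<in> ?A) ?L"
  define ms where "ms = filter (\<lambda>p. p \<notin> ?A) ?L"
  have fin: "finite (?A \<union> ?R)" using finite_addable[OF Y] finite_removable[OF Y] by simp
  have set_L: "set ?L = ?A \<union> ?R" by (rule ladder_reading(1)[OF l2 fin])
  have L: "?L = ps @ ms"
    unfolding ps_def ms_def
  proof (rule sorted_wrt_partition[OF ladder_reading(2)[OF l2 fin]])
    fix q p assume "q \<in> set ?L" "q \<notin> ?A" "p \<in> ?A"
    then have "ladder_less l p q"
      using ladder_less_addable_removable[OF assms(1,2)] set_L by blast
    then show "\<not> ladder_less l q p" by (auto simp: ladder_less_def)
  qed
  have dist: "distinct (ps @ ms)" using distinct_ladder_reading[OF l2 fin] L by simp
  have "?A \<inter> ?R = {}" by (auto simp: addable_boxes_def removable_boxes_def)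
  then have sets: "set ps = ?A" "set ms = ?R" using set_L by (auto simp: ps_def ms_def)
  have len: "phi_hat l i lam = length ps" "epsilon_hat l i lam = length ms"
    using reduced_no_cancellation[OF L sets] by (simp_all add: phi_hat_def epsilon_hat_def)
  let ?X = "beads lam" and ?r = "\<lambda>x. x mod int l"
  have succ: "?r (x + 1) = ?r (y + 1) \<longleftrightarrow> ?r x = ?r y" for x y
    by (simp add: mod_eq_dvd_iff)
  have ne: "?r (x + 1) \<noteq> ?r x" for x
    using l2 by (simp add: mod_eq_dvd_iff zdvd1_eq)
  have J: "JM_abacus ?r ?X" using assms(2) by (simp add: JM_partition_iff_abacus)
  have mem_pred: "c \<in> (\<lambda>p. content p - 1) ` S \<longleftrightarrow> c + 1 \<in> content ` S" for c S
    unfolding image_iff by (intro bex_cong) auto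
  obtain E where E: "iterate_partial (f_hat l i) (length ps) lam = Some E" "young_diagram E"
    "beads E = (?X - (\<lambda>p. content p - 1) ` set ps) \<union> content ` set ps"
    using iterate_f_hat[OF l2 Y L dist sets] by blast
  \<comment> \<open>Every bead at \<open>p - 1\<close> with a gap at \<open>p\<close> on runner
    \<open>i\<close> has slid up. So \<open>p\<close> is filled if at least one of the two was, and
    \<open>p - 1\<close> stays filled only if both were.\<close>
  have "JM_abacus ?r (beads E)"
  proof (rule JM_abacus_add[OF succ ne J, where c = i])
    fix p
    show "p \<in> beads E \<longleftrightarrow> (if ?r p = i then p \<in> ?X \<or> p - 1 \<in> ?X
      else if ?r (p + 1) = i then p \<in> ?X \<and> p + 1 \<in> ?X else p \<in> ?X)"
      unfolding E(3) sets(1) Un_iff Diff_iff mem_pred content_addable[OF Y]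
      using ne[of p] by auto
  qed
  moreover obtain F where F: "iterate_partial (e_hat l i) (length ms) lam = Some F" "young_diagram F"
    "beads F = (?X - content ` set ms) \<union> (\<lambda>p. content p - 1) ` set ms"
    using iterate_e_hat[OF l2 Y L dist sets] by blast
  \<comment> \<open>Every bead on runner \<open>i\<close> with a gap just before it has slid down,
    which exchanges union and intersection.\<close>
  moreover have "JM_abacus ?r (beads F)"
  proof (rule JM_abacus_remove[OF succ ne J, where c = i])
    fix p
    show "p \<in> beads F \<longleftrightarrow> (if ?r p = i then p \<in> ?X \<and> p - 1 \<in> ?X
      else if ?r (p + 1) = i then p \<in> ?X \<or> p + 1 \<in> ?X else p \<in> ?X)"
      unfolding F(3) sets(2) Un_iff Diff_iff mem_pred content_removable[OF Y]
      using ne[of p] by auto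
  qed
  ultimately show ?thesis using E by (simp add: len JM_partition_iff_abacus)
qed

end
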